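(* Let $p$ be an odd prime, $q=p^r$ with $r>0$, $k=\mathbb{F}_q$, and let $g$ be a generator of the cyclic group $k^\times$. Let $G\subset GL_6(k)$ be the group $\{\hat A : A\in GL_4(k)\}$, where for $A=(a_{ij})\in GL_4(k)$ the matrix $\hat A$ has rows and columns indexed by the pairs $(r,s)$, $1\le r<s\le 4$, ordered lexicographically $12<13<14<23<24<34$, with entry $a_{ri}a_{sj}-a_{si}a_{rj}$ in row $(r,s)$ and column $(i,j)$. Let $G$ act on the set of $2$-dimensional subspaces of $k^6$ (spaces of row vectors) by right multiplication. Then there are at most $4$ orbits; in particular every $2$-dimensional subspace of $k^6$ lies in the $G$-orbit of the row space of one of the following matrices: (1) $\begin{bmatrix}0&0&0&0&0&1\\1&0&0&0&0&0\end{bmatrix}$, (2) $\begin{bmatrix}0&0&0&0&0&1\\0&0&1&0&0&0\end{bmatrix}$, (3) $\begin{bmatrix}0&0&0&0&0&1\\0&0&1&1&0&0\end{bmatrix}$, (4) $\begin{bmatrix}0&0&1&1&0&0\\0&1&0&0&g&0\end{bmatrix}$.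
   Context: The coordinates of $k^6$ correspond to the basis $x_{12},x_{13},x_{14},x_{23},x_{24},x_{34}$ (in this order) of the degree-$2$ component of the free Lie algebra over $k$ on $x_1,\dots,x_4$, with $x_{ij}=[x_i,x_j]$; $\hat A=\bigwedge^2 A$. *)

theory Defs
  imports "HOL-Analysis.Analysis"
begin

text \<open>
  Coordinates of \<open>'k^6\<close> are listed as \<open>1, ..., 6\<close> and those of \<open>'k^4\<close> as \<open>1, ..., 4\<close>. In the
  numeral types, \<open>6 = 0\<close> and \<open>4 = 0\<close>, so their built-in orders are not the orders meant
  here; the pairs \<open>12 < 13 < 14 < 23 < 24 < 34\<close> are therefore spelled out.
\<close>

definition index_pair :: "6 \<Rightarrow> 4 \<times> 4" where
  "index_pair u =
     (if u = 1 then (1, 2) else if u = 2 then (1, 3) else if u = 3 then (1, 4)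
      else if u = 4 then (2, 3) else if u = 5 then (2, 4) else (3, 4))"

lemma exhaust_6:
  fixes u :: 6
  shows "u = 1 \<or> u = 2 \<or> u = 3 \<or> u = 4 \<or> u = 5 \<or> u = 6"
proof (induct u)
  case (of_int z)
  then have "z = 0 \<or> z = 1 \<or> z = 2 \<or> z = 3 \<or> z = 4 \<or> z = 5"
    by auto
  then show ?case
    by auto
qed

lemma UNIV_6: "UNIV = {1, 2, 3, 4, 5, 6 :: 6}"
  using exhaust_6 by auto

lemma forall_6: "(\<forall>u::6. P u) \<longleftrightarrow> P 1 \<and> P 2 \<and> P 3 \<and> P 4 \<and> P 5 \<and> P 6"
  by (metis exhaust_6)

lemma sum_6: "sum f (UNIV :: 6 set) = f 1 + f 2 + f 3 + f 4 + f 5 + f 6"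
  unfolding UNIV_6 by (simp add: ac_simps)

lemma index_pair_simps [simp]:
  "index_pair 1 = (1, 2)" "index_pair 2 = (1, 3)" "index_pair 3 = (1, 4)"
  "index_pair 4 = (2, 3)" "index_pair 5 = (2, 4)" "index_pair 6 = (3, 4)"
  by (simp_all add: index_pair_def)

lemma vector_6 [simp]:
  "(vector [a, b, c, d, e, f] :: 'a::zero^6) $ 1 = a"
  "(vector [a, b, c, d, e, f] :: 'a::zero^6) $ 2 = b"
  "(vector [a, b, c, d, e, f] :: 'a::zero^6) $ 3 = c"
  "(vector [a, b, c, d, e, f] :: 'a::zero^6) $ 4 = d"
  "(vector [a, b, c, d, e, f] :: 'a::zero^6) $ 5 = e"
  "(vector [a, b, c, d, e, f] :: 'a::zero^6) $ 6 = f"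
  unfolding vector_def by simp_all

definition wedge2 :: "'k::comm_ring_1^4^4 \<Rightarrow> 'k^6^6" where
  "wedge2 A = (\<chi> u v. case (index_pair u, index_pair v) of
     ((r, s), (i, j)) \<Rightarrow> A $ r $ i * A $ s $ j - A $ s $ i * A $ r $ j)"

lemma wedge2_mat_1: "wedge2 (mat 1) = mat 1"
  by (simp add: vec_eq_iff wedge2_def mat_def forall_6)

lemma wedge2_mult: "wedge2 (A ** B) = wedge2 A ** wedge2 B"
  by (simp add: vec_eq_iff wedge2_def matrix_matrix_mult_def forall_6 sum_4 sum_6)
     (intro conjI; simp add: algebra_simps)

definition wedge2_group :: "('k::field^6^6) set" where
  "wedge2_group = wedge2 ` {A :: 'k^4^4. invertible A}"

lemma wedge2_group_mat_1: "mat 1 \<in> wedge2_group"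
  unfolding wedge2_group_def image_iff
  by (rule bexI[of _ "mat 1"]) (auto simp: wedge2_mat_1 invertible_def intro: exI[of _ "mat 1"])

lemma wedge2_group_mult: "M \<in> wedge2_group \<Longrightarrow> N \<in> wedge2_group \<Longrightarrow> M ** N \<in> wedge2_group"
  by (auto simp: wedge2_group_def wedge2_mult[symmetric] invertible_mult)

lemma wedge2_group_inverse:
  assumes "M \<in> wedge2_group"
  shows "\<exists>N \<in> wedge2_group. M ** N = mat 1 \<and> N ** M = mat 1"
proof -
  from assms obtain A where M: "M = wedge2 A" and "invertible A"
    by (auto simp: wedge2_group_def)
  then obtain B where B: "A ** B = mat 1" "B ** A = mat 1"
    by (auto simp: invertible_def)
  then have "invertible B"
    by (auto simp: invertible_def)
  then show ?thesis
    unfolding wedge2_group_def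
    by (intro bexI[of _ "wedge2 B"]) (auto simp: M B wedge2_mult[symmetric] wedge2_mat_1)
qed

definition planes :: "('k::field^'n) set set" where
  "planes = {W. vec.subspace W \<and> vec.dim W = 2}"

definition row_space :: "'k::field^'n^'m \<Rightarrow> ('k^'n) set" where
  "row_space M = vec.span (rows M)"

definition wedge2_orbit :: "('k::field^6) set \<Rightarrow> ('k^6) set set" where
  "wedge2_orbit W = (\<lambda>M. (\<lambda>v. v v* M) ` W) ` wedge2_group"

definition generates_units :: "'k::field \<Rightarrow> bool" where
  "generates_units g \<longleftrightarrow> range (\<lambda>n::int. g powi n) = UNIV - {0}"

end

theory Submission
  imports Defs "HOL-Number_Theory.Residues"
begin

text \<open>
  A row vector \<open>v\<close> of \<open>k^6\<close> is a bivector, i.e. an alternating form \<open>\<omega>\<close> on \<open>k^4\<close>, and the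
  coordinates of \<open>v v* wedge2 A\<close> are the values of \<open>\<omega>\<close> on pairs of columns of \<open>A\<close>. Every
  nonzero \<open>v\<close> is thereby equivalent to \<open>c e\<^sub>1\<^sub>2 + e\<^sub>3\<^sub>4\<close>, with \<open>c = 0\<close> exactly when its
  Pfaffian vanishes. If a plane contains a nonzero vector of Pfaffian zero, move that vector to
  \<open>e\<^sub>3\<^sub>4\<close>; a second basis vector \<open>w\<close> is then normalised to \<open>e\<^sub>1\<^sub>2\<close> if \<open>w\<^sub>1\<^sub>2 \<noteq> 0\<close>, and
  otherwise it is a \<open>2 \<times> 2\<close> matrix of rank \<open>1\<close> or \<open>2\<close>, giving \<open>e\<^sub>1\<^sub>4\<close> or \<open>e\<^sub>1\<^sub>4 + e\<^sub>2\<^sub>3\<close>.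

  If the Pfaffian is anisotropic on the plane, take \<open>e\<^sub>1\<^sub>4 + e\<^sub>2\<^sub>3\<close> as first basis vector, with form
  \<open>\<omega>\<close>, and \<open>w\<close> orthogonal to it (here \<open>p\<close> is odd). The operator \<open>T\<close> with
  \<open>w(x, y) = \<omega>(x, T y)\<close> satisfies \<open>T\<^sup>2 = - pf w\<close>, a nonsquare, which may be rescaled to \<open>g\<close>. If
  \<open>\<omega>(x, y) = 0\<close> and \<open>w(x, y) = 1\<close>, then in the basis \<open>x, T x, y, T y\<close> the two forms are
  \<open>e\<^sub>1\<^sub>4 + e\<^sub>2\<^sub>3\<close> and \<open>e\<^sub>1\<^sub>3 + g e\<^sub>2\<^sub>4\<close>.
\<close>

section \<open>Coordinates and invertibility of small matrices\<close>

lemma vector_4 [simp]: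
  "(vector [a, b, c, d] :: 'a::zero^4) $ 1 = a"
  "(vector [a, b, c, d] :: 'a::zero^4) $ 2 = b"
  "(vector [a, b, c, d] :: 'a::zero^4) $ 3 = c"
  "(vector [a, b, c, d] :: 'a::zero^4) $ 4 = d"
  unfolding vector_def by simp_all

lemma vec6_eq_iff:
  "v = w \<longleftrightarrow> v $ 1 = w $ 1 \<and> v $ 2 = w $ 2 \<and> v $ 3 = w $ 3 \<and> v $ 4 = w $ 4 \<and> v $ 5 = w $ 5 \<and> v $ 6 = w $ 6"
  for v w :: "'a^6"
  by (simp add: vec_eq_iff forall_6)

lemma row_space_vector_2: "row_space (vector [v, w] :: 'k::field^'n^2) = vec.span {v, w}"
proof -
  have "rows (vector [v, w] :: 'k^'n^2) = (\<lambda>i. vector [v, w] $ i) ` {1, 2 :: 2}"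
    unfolding UNIV_2[symmetric] by (auto simp: rows_def row_def vec_lambda_eta)
  then show ?thesis
    by (simp add: row_space_def)
qed

lemma invertible_kerI:
  fixes A :: "'k::field^'n^'n"
  assumes "\<And>x. A *v x = 0 \<Longrightarrow> x = 0"
  shows "invertible A"
  using assms by (auto simp: invertible_left_inverse matrix_left_invertible_ker)

lemma invertible_4I:
  fixes A :: "'k::field^4^4"
  assumes "\<And>a b c d. \<lbrakk>A$1$1 * a + A$1$2 * b + A$1$3 * c + A$1$4 * d = 0;
      A$2$1 * a + A$2$2 * b + A$2$3 * c + A$2$4 * d = 0;
      A$3$1 * a + A$3$2 * b + A$3$3 * c + A$3$4 * d = 0;
      A$4$1 * a + A$4$2 * b + A$4$3 * c + A$4$4 * d = 0\<rbrakk> \<Longrightarrow> a = 0 \<and> b = 0 \<and> c = 0 \<and> d = 0"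
  shows "invertible A"
proof (rule invertible_kerI)
  fix x assume "A *v x = 0"
  with assms[of "x$1" "x$2" "x$3" "x$4"] show "x = 0"
    by (simp add: matrix_vector_mult_def vec_eq_iff forall_4 sum_4)
qed

lemma det_2_kernel:
  fixes p q r s x y :: "'k::field"
  assumes "p * s - q * r \<noteq> 0" "p * x + q * y = 0" "r * x + s * y = 0"
  shows "x = 0 \<and> y = 0"
proof -
  \<comment> \<open>Cramer's rule: the adjugate combinations of the two equations isolate
    \<open>x\<close> and \<open>y\<close>.\<close>
  have "(p * s - q * r) * x = s * (p * x + q * y) - q * (r * x + s * y)"
    "(p * s - q * r) * y = p * (r * x + s * y) - r * (p * x + q * y)"
    by (simp_all add: algebra_simps)
  then have "(p * s - q * r) * x = 0" "(p * s - q * r) * y = 0"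
    by (simp_all only: assms(2,3) mult_zero_right diff_self)
  then show ?thesis
    using assms(1) by (simp only: mult_eq_0_iff simp_thms)
qed

lemma invertible_block_diagonal:
  fixes p q r s p' q' r' s' :: "'k::field"
  assumes "p * s - q * r \<noteq> 0" "p' * s' - q' * r' \<noteq> 0"
  shows "invertible (vector [vector [p, q, 0, 0], vector [r, s, 0, 0],
    vector [0, 0, p', q'], vector [0, 0, r', s']] :: 'k^4^4)"
proof (rule invertible_4I, goal_cases)
  case (1 a b c d)
  then show ?case
    using det_2_kernel[OF assms(1), of a b] det_2_kernel[OF assms(2), of c d] by simp
qed

section \<open>Orbits and bases of planes\<close>

lemma linear_vector_matrix_mult: "Vector_Spaces.linear (*s) (*s) (\<lambda>v. v v* (M :: 'k::field^'n^'m))"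
  by (simp only: transpose_matrix_vector[symmetric]) (rule matrix_vector_mul_linear_gen)

lemma image_wedge2_in_orbit:
  "invertible A \<Longrightarrow> (\<lambda>v. v v* wedge2 A) ` W \<in> wedge2_orbit W"
  by (auto simp: wedge2_orbit_def wedge2_group_def)

lemma span_pair_in_wedge2_orbit:
  assumes "invertible A"
  shows "vec.span {v v* wedge2 A, w v* wedge2 A} \<in> wedge2_orbit (vec.span {v, w})"
proof -
  have "vec.span {v v* wedge2 A, w v* wedge2 A} = (\<lambda>v. v v* wedge2 A) ` vec.span {v, w}"
    using vec.linear_span_image[OF linear_vector_matrix_mult, of "wedge2 A" "{v, w}"] by simp
  then show ?thesis
    using image_wedge2_in_orbit[OF assms] by simp
qed

lemma wedge2_orbit_sym:
  assumes "W \<in> wedge2_orbit U"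
  shows "U \<in> wedge2_orbit W"
proof -
  obtain M where M: "M \<in> wedge2_group" "W = (\<lambda>v. v v* M) ` U"
    using assms by (auto simp: wedge2_orbit_def)
  then obtain N where "N \<in> wedge2_group" "M ** N = mat 1"
    using wedge2_group_inverse by blast
  then show ?thesis
    unfolding wedge2_orbit_def
    by (intro image_eqI[of _ _ N]) (simp_all add: M image_image vector_matrix_mul_assoc)
qed

lemma wedge2_orbit_trans:
  assumes "V \<in> wedge2_orbit U" "W \<in> wedge2_orbit V"
  shows "W \<in> wedge2_orbit U"
proof -
  obtain M N where "M \<in> wedge2_group" "V = (\<lambda>v. v v* M) ` U" "N \<in> wedge2_group" "W = (\<lambda>v. v v* N) ` V"
    using assms by (auto simp: wedge2_orbit_def)
  then show ?thesis
    unfolding wedge2_orbit_def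
    by (intro image_eqI[of _ _ "M ** N"])
      (simp_all add: image_image vector_matrix_mul_assoc wedge2_group_mult)
qed

lemma wedge2_orbit_eq: "W \<in> wedge2_orbit U \<Longrightarrow> wedge2_orbit W = wedge2_orbit U"
  by (blast intro: wedge2_orbit_sym wedge2_orbit_trans)

lemma planes_wedge2_orbit:
  assumes "W \<in> planes" "V \<in> wedge2_orbit W"
  shows "V \<in> planes"
proof -
  obtain M where M: "M \<in> wedge2_group" "V = (\<lambda>v. v v* M) ` W"
    using assms by (auto simp: wedge2_orbit_def)
  then obtain N where "M ** N = mat 1"
    using wedge2_group_inverse by blast
  then have "inj (\<lambda>v. v v* M)"
    by (intro inj_on_inverseI[of _ "\<lambda>v. v v* N"]) (simp add: vector_matrix_mul_assoc)
  then show ?thesis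
    using assms M vec.linear_subspace_image[OF linear_vector_matrix_mult, of W M]
      vec.dim_image_eq[OF linear_vector_matrix_mult, of M W]
    by (auto simp: planes_def inj_on_def vec.span_eq_iff)
qed

lemma planes_pair:
  assumes "W \<in> planes" "v \<in> W" "w \<in> W" "w \<notin> vec.span {v}" "v \<noteq> 0"
  shows "W = vec.span {v, w}"
proof -
  have W: "vec.subspace W" "vec.dim W = 2"
    using assms(1) by (auto simp: planes_def)
  have "vec.dim {v, w} = 2"
    using assms by (simp add: vec.dim_insert insert_commute[of v])
  then show ?thesis
    using W assms vec.subspace_dim_equal[of "vec.span {v, w}" W]
    by (simp add: vec.span_minimal)
qed

lemma planes_nonzero:
  fixes W :: "('k::field^'n) set"
  assumes "W \<in> planes"
  obtains v where "v \<in> W" "v \<noteq> 0"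
proof (rule ccontr)
  assume "\<not> thesis"
  then have "W \<subseteq> {0}" using that by auto
  then have "vec.dim W = 0" by simp
  then show False using assms by (simp add: planes_def del: vec.dim_eq_0)
qed

lemma planes_complement:
  assumes "W \<in> planes"
  obtains w where "w \<in> W" "w \<notin> vec.span {v}"
proof (rule ccontr)
  assume "\<not> thesis"
  then have "W \<subseteq> vec.span {v}" using that by auto
  then have "vec.dim W \<le> vec.dim {v}" by (metis vec.dim_mono)
  also have "\<dots> \<le> 1" by (simp add: vec.dim_insert)
  finally show False using assms by (simp add: planes_def)
qed

section \<open>The Pfaffian and the normal form of one bivector\<close>

definition pfaffian :: "'k::comm_ring_1^6 \<Rightarrow> 'k" where
  "pfaffian v = v $ 1 * v $ 6 - v $ 2 * v $ 5 + v $ 3 * v $ 4"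

lemmas wedge2_action_simps = vec6_eq_iff vector_matrix_mult_def sum_6 wedge2_def

text \<open>The zeros of the Pfaffian are the decomposable bivectors. A permutation of the basis
  changes the Pfaffian at most in sign, so its vanishing survives.\<close>

lemma ex_wedge2_last_coord:
  fixes v :: "'k::field^6"
  assumes "v \<noteq> 0"
  obtains A :: "'k^4^4" where "invertible A" "(v v* wedge2 A) $ 6 \<noteq> 0"
    "pfaffian v = 0 \<Longrightarrow> pfaffian (v v* wedge2 A) = 0"
proof -
  \<comment> \<open>\<open>A u\<close> is a permutation matrix moving the pair with index \<open>u\<close> to the last place.\<close>
  define A :: "6 \<Rightarrow> 'k^4^4" where "A u =
    (if u = 1 then vector [vector [0,0,1,0], vector [0,0,0,1], vector [1,0,0,0], vector [0,1,0,0]]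
     else if u = 2 then vector [vector [0,0,1,0], vector [1,0,0,0], vector [0,0,0,1], vector [0,1,0,0]]
     else if u = 3 then vector [vector [0,0,1,0], vector [1,0,0,0], vector [0,1,0,0], vector [0,0,0,1]]
     else if u = 4 then vector [vector [1,0,0,0], vector [0,0,1,0], vector [0,0,0,1], vector [0,1,0,0]]
     else if u = 5 then vector [vector [1,0,0,0], vector [0,0,1,0], vector [0,1,0,0], vector [0,0,0,1]]
     else mat 1)" for u
  have inv: "\<forall>u. invertible (A u)"
    unfolding forall_6 by (intro conjI invertible_4I) (simp_all add: A_def mat_def)
  have last: "\<forall>u. (v v* wedge2 (A u)) $ 6 = v $ u"
    unfolding forall_6 by (simp add: A_def wedge2_action_simps mat_def)
  have pf: "\<forall>u. pfaffian v = 0 \<longrightarrow> pfaffian (v v* wedge2 (A u)) = 0"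
    unfolding forall_6 pfaffian_def by (simp add: A_def wedge2_action_simps mat_def algebra_simps)
  obtain u where "v $ u \<noteq> 0"
    using assms by (auto simp: vec_eq_iff)
  then show ?thesis
    using that[of "A u"] inv last pf by auto
qed

lemma wedge2_normal_form:
  fixes v :: "'k::field^6"
  assumes "v \<noteq> 0"
  obtains A :: "'k^4^4" and c where "invertible A" "v v* wedge2 A = vector [c, 0, 0, 0, 0, 1]"
    "pfaffian v = 0 \<Longrightarrow> c = 0"
proof -
  obtain A where A: "invertible A" "(v v* wedge2 A) $ 6 \<noteq> 0"
    "pfaffian v = 0 \<Longrightarrow> pfaffian (v v* wedge2 A) = 0"
    using ex_wedge2_last_coord[OF assms] by blast
  define u where "u = v v* wedge2 A"
  have u: "u $ 6 \<noteq> 0"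
    using A(2) by (simp add: u_def)
  \<comment> \<open>Symplectic Gram-Schmidt for the form \<open>u\<close>: columns 1 and 2 are e_1
    and e_2 made orthogonal to e_3 and e_4, and column 3 is e_3 scaled so that the last coordinate
    becomes 1.\<close>
  define B :: "'k^4^4" where "B = vector [vector [1, 0, 0, 0], vector [0, 1, 0, 0],
    vector [- u$3 / u$6, - u$5 / u$6, 1 / u$6, 0], vector [u$2 / u$6, u$4 / u$6, 0, 1]]"
  have "invertible B"
    by (rule invertible_4I) (use u in \<open>simp_all add: B_def\<close>)
  moreover have "u v* wedge2 B = vector [pfaffian u / u$6, 0, 0, 0, 0, 1]"
    using u by (simp add: wedge2_action_simps B_def pfaffian_def field_simps)
  ultimately show ?thesis
    using A that[of "A ** B" "pfaffian u / u$6"]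
    by (auto simp: invertible_mult wedge2_mult vector_matrix_mul_assoc[symmetric] u_def)
qed

section \<open>Changing the basis of a plane\<close>

lemma span_pair_change:
  fixes v w :: "'k::field^'n"
  assumes "a \<noteq> 0" "c \<noteq> 0"
  shows "vec.span {a *s v, b *s v + c *s w} = vec.span {v, w}" (is "vec.span {?v, ?w} = _")
proof -
  have "v = (1 / a) *s ?v" "w = (1 / c) *s ?w - (b / (a * c)) *s ?v"
    using assms by (simp_all add: vec_eq_iff field_simps)
  then have "v \<in> vec.span {?v, ?w}" "w \<in> vec.span {?v, ?w}"
    by (metis vec.span_scale vec.span_base vec.span_diff insertI1 insertI2)+
  moreover have "?v \<in> vec.span {v, w}" "?w \<in> vec.span {v, w}"
    by (simp_all add: vec.span_scale vec.span_base vec.span_add)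
  ultimately show ?thesis
    by (auto simp: vec.span_eq)
qed

text \<open>Lets a normalising matrix be checked up to a triangular change of basis: only the class
  of the second image modulo the first, up to scaling, matters.\<close>

lemma wedge2_orbit_pairI:
  assumes "invertible A" "v v* wedge2 A = a *s v'" "w v* wedge2 A = b *s v' + c *s w'" "a \<noteq> 0" "c \<noteq> 0"
  shows "vec.span {v, w} \<in> wedge2_orbit (vec.span {v', w'})"
proof (rule wedge2_orbit_sym)
  show "vec.span {v', w'} \<in> wedge2_orbit (vec.span {v, w})"
    using span_pair_in_wedge2_orbit[OF assms(1), of v w] assms span_pair_change[of a c v' b w'] by simp
qed

text \<open>The free function \<open>t\<close> serves two purposes: clearing a coordinate of the
  second basis vector, and making it orthogonal to the first.\<close>

lemma planes_split:
  assumes "W \<in> planes" "v \<in> W" "v \<noteq> 0"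
  obtains w where "w \<notin> vec.span {v}" "W = vec.span {v, w - t w *s v}"
proof -
  obtain w where w: "w \<in> W" "w \<notin> vec.span {v}"
    using planes_complement[OF assms(1)] by blast
  have "W = vec.span {v, w}"
    using planes_pair[OF assms(1,2) w assms(3)] .
  also have "\<dots> = vec.span {v, w - t w *s v}"
    using span_pair_change[of 1 1 v "- t w" w] by simp
  finally show ?thesis
    using that w by blast
qed

section \<open>Planes containing a decomposable vector\<close>

lemma rank_one_2x2:
  fixes p q r s :: "'k::field"
  assumes "p * s = q * r"
  obtains a b c d where "p = a * c" "q = a * d" "r = b * c" "s = b * d"
proof -
  consider "p \<noteq> 0" | "p = 0" "q \<noteq> 0" | "p = 0" "q = 0" by blast
  then show ?thesis
  proof cases
    case 1
    then show ?thesis using assms that[of 1 p q "r / p"] by (simp add: field_simps)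
  next
    case 2
    then show ?thesis using assms that[of 1 p q "s / q"] by (simp add: field_simps)
  next
    case 3
    then show ?thesis using that[of 0 r s 1] by simp
  qed
qed

lemma bezout_field:
  fixes a b :: "'k::field"
  assumes "\<not> (a = 0 \<and> b = 0)"
  obtains x y where "a * x + b * y = 1"
proof (cases "a = 0")
  case True
  then show ?thesis using assms that[of 0 "1 / b"] by simp
next
  case False
  then show ?thesis using that[of "1 / a" 0] by simp
qed

lemma plane_with_decomposable:
  fixes W :: "('k::field^6) set"
  assumes "W \<in> planes" "vector [0, 0, 0, 0, 0, 1] \<in> W"
  shows "\<exists>v \<in> {vector [1, 0, 0, 0, 0, 0], vector [0, 0, 1, 0, 0, 0], vector [0, 0, 1, 1, 0, 0]}.
    W \<in> wedge2_orbit (vec.span {vector [0, 0, 0, 0, 0, 1], v})"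
proof -
  define e :: "'k^6" where "e = vector [0, 0, 0, 0, 0, 1]"
  have "e \<noteq> 0"
    by (simp add: e_def vec6_eq_iff)
  then obtain w0 where w0: "w0 \<notin> vec.span {e}" "W = vec.span {e, w0 - w0 $ 6 *s e}"
    using planes_split[OF assms(1), of e "\<lambda>w. w $ 6"] assms(2) unfolding e_def by blast
  define w where "w = w0 - w0 $ 6 *s e"
  have W: "W = vec.span {e, w}" and w6: "w $ 6 = 0"
    using w0 by (simp_all add: w_def e_def)
  have "w \<noteq> 0"
    using w0(1) by (metis w_def eq_iff_diff_eq_0 insertI1 vec.span_base vec.span_scale)
  \<comment> \<open>Since \<open>w $ 6 = 0\<close>, this is \<open>- pfaffian w\<close>. It is also
    the determinant of the block P with rows (w_13, w_14) and (w_23, w_24), which pairs e_1, e_2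
    with e_3, e_4.\<close>
  define \<delta> where "\<delta> = w $ 2 * w $ 5 - w $ 3 * w $ 4"
  consider "w $ 1 \<noteq> 0" | "w $ 1 = 0" "\<delta> \<noteq> 0" | "w $ 1 = 0" "\<delta> = 0"
    by blast
  then show ?thesis
  proof cases
    case 1
    \<comment> \<open>Columns 3 and 4 are e_3 and e_4 made orthogonal to e_1 and e_2 for the form
      \<open>w\<close>. The new coordinate 34 is absorbed by \<open>e\<close>.\<close>
    define A :: "'k^4^4" where "A = vector [vector [1, 0, w$4 / w$1, w$5 / w$1],
      vector [0, 1, - w$2 / w$1, - w$3 / w$1], vector [0, 0, 1, 0], vector [0, 0, 0, 1]]"
    have "invertible A"
      by (rule invertible_4I) (simp_all add: A_def)
    moreover have "e v* wedge2 A = 1 *s e"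
      by (simp add: wedge2_action_simps A_def e_def)
    moreover have "w v* wedge2 A = (w v* wedge2 A) $ 6 *s e + w$1 *s vector [1, 0, 0, 0, 0, 0]"
      using 1 by (simp add: wedge2_action_simps A_def e_def field_simps)
    ultimately have "W \<in> wedge2_orbit (vec.span {e, vector [1, 0, 0, 0, 0, 0]})"
      unfolding W by (rule wedge2_orbit_pairI) (use 1 in \<open>simp_all\<close>)
    then show ?thesis by (simp add: e_def)
  next
    case 2
    \<comment> \<open>The lower block is the inverse of P times the swap matrix, so P becomes the
      swap, which is e_14 + e_23.\<close>
    define A :: "'k^4^4" where "A = vector [vector [1, 0, 0, 0], vector [0, 1, 0, 0],
      vector [0, 0, - w$3 / \<delta>, w$5 / \<delta>], vector [0, 0, w$2 / \<delta>, - w$4 / \<delta>]]"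
    have "invertible A"
      unfolding A_def
    proof (rule invertible_block_diagonal)
      have "(- w$3 / \<delta>) * (- w$4 / \<delta>) - (w$5 / \<delta>) * (w$2 / \<delta>) = - (w$2 * w$5 - w$3 * w$4) / (\<delta> * \<delta>)"
        by (simp add: diff_divide_distrib)
      then show "(- w$3 / \<delta>) * (- w$4 / \<delta>) - (w$5 / \<delta>) * (w$2 / \<delta>) \<noteq> 0"
        using 2 by (simp flip: \<delta>_def)
    qed simp
    moreover have "e v* wedge2 A = (- 1 / \<delta>) *s e"
      using 2 by (simp add: wedge2_action_simps A_def e_def field_simps) (simp add: \<delta>_def algebra_simps)
    moreover have "w v* wedge2 A = 0 *s e + 1 *s vector [0, 0, 1, 1, 0, 0]"
      using 2 w6 by (simp add: wedge2_action_simps A_def e_def field_simps) (simp add: \<delta>_def algebra_simps)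
    ultimately have "W \<in> wedge2_orbit (vec.span {e, vector [0, 0, 1, 1, 0, 0]})"
      unfolding W by (rule wedge2_orbit_pairI) (use 2 in \<open>simp_all\<close>)
    then show ?thesis by (simp add: e_def)
  next
    case 3
    then have "w $ 2 * w $ 5 = w $ 3 * w $ 4"
      by (simp add: \<delta>_def)
    then obtain a b c d where abcd: "w $ 2 = a * c" "w $ 3 = a * d" "w $ 4 = b * c" "w $ 5 = b * d"
      using rank_one_2x2 by metis
    then have "\<not> (a = 0 \<and> b = 0)" "\<not> (d = 0 \<and> c = 0)"
      using \<open>w \<noteq> 0\<close> 3 w6 by (auto simp: vec6_eq_iff)
    then obtain \<alpha> \<beta> \<gamma> \<eta> where bez: "a * \<alpha> + b * \<beta> = 1" "d * \<eta> + c * \<gamma> = 1"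
      using bezout_field by metis
    then have prod: "(a * \<alpha> + b * \<beta>) * (d * \<eta> + c * \<gamma>) = 1"
      by simp
    \<comment> \<open>Here w(x, y) = (a x_1 + b x_2)(c y_3 + d y_4) for x in the span of e_1, e_2
      and y in that of e_3, e_4. Columns 2 and 3 lie in the kernels of the two factors, while
      columns 1 and 4 give them the value 1.\<close>
    define A :: "'k^4^4" where "A = vector [vector [\<alpha>, - b, 0, 0], vector [\<beta>, a, 0, 0],
      vector [0, 0, d, \<gamma>], vector [0, 0, - c, \<eta>]]"
    have "invertible A"
      unfolding A_def by (rule invertible_block_diagonal) (use bez in \<open>simp_all add: mult.commute\<close>)
    moreover have "e v* wedge2 A = 1 *s e"
      by (simp add: wedge2_action_simps A_def e_def) (use bez in algebra)
    moreover have "w v* wedge2 A = 0 *s e + 1 *s vector [0, 0, 1, 0, 0, 0]"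
      using 3 w6 prod by (simp add: wedge2_action_simps A_def e_def abcd algebra_simps)
    ultimately have "W \<in> wedge2_orbit (vec.span {e, vector [0, 0, 1, 0, 0, 0]})"
      unfolding W by (rule wedge2_orbit_pairI) simp_all
    then show ?thesis by (simp add: e_def)
  qed
qed

section \<open>Planes on which the Pfaffian is anisotropic\<close>

lemma plane_without_decomposable:
  fixes W :: "('k::field^6) set"
  assumes "W \<in> planes" "\<And>V. V \<in> wedge2_orbit W \<Longrightarrow> vector [0, 0, 0, 0, 0, 1] \<notin> V"
    and two: "(2 :: 'k) \<noteq> 0"
    and gen: "\<And>d. (\<nexists>s. d = s\<^sup>2) \<Longrightarrow> \<exists>s. s \<noteq> 0 \<and> d = g * s\<^sup>2"
  shows "W \<in> wedge2_orbit (vec.span {vector [0, 0, 1, 1, 0, 0], vector [0, 1, 0, 0, g, 0]})"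
proof -
  define f :: "'k^6" where "f = vector [0, 0, 1, 1, 0, 0]"
  obtain v where v: "v \<in> W" "v \<noteq> 0"
    using planes_nonzero[OF assms(1)] by blast
  obtain A c where A: "invertible A" "v v* wedge2 A = vector [c, 0, 0, 0, 0, 1]"
    using wedge2_normal_form[OF v(2)] by metis
  have c: "c \<noteq> 0"
    using assms(2)[OF image_wedge2_in_orbit[OF A(1)]] A(2) v(1) by (metis image_eqI)
  \<comment> \<open>The columns e_1 / c, e_3, e_4, e_2 turn c e_12 + e_34 into e_14 + e_23.\<close>
  define B :: "'k^4^4" where "B = vector [vector [1 / c, 0, 0, 0], vector [0, 0, 0, 1],
    vector [0, 1, 0, 0], vector [0, 0, 1, 0]]"
  have "invertible B"
    by (rule invertible_4I) (use c in \<open>simp_all add: B_def\<close>)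
  then have AB: "invertible (A ** B)"
    using A by (simp add: invertible_mult)
  have "vector [c, 0, 0, 0, 0, 1] v* wedge2 B = f"
    using c by (simp add: wedge2_action_simps B_def f_def)
  then have vf: "v v* wedge2 (A ** B) = f"
    using A by (simp add: wedge2_mult vector_matrix_mul_assoc[symmetric])
  define V where "V = (\<lambda>v. v v* wedge2 (A ** B)) ` W"
  have V: "V \<in> wedge2_orbit W" "f \<in> V"
    using image_wedge2_in_orbit[OF AB] v vf by (auto simp: V_def)
  then have "V \<in> planes"
    using planes_wedge2_orbit assms(1) by blast
  have pfaffian_anisotropic: "u = 0" if u: "u \<in> V" "pfaffian u = 0" for u
  proof (rule ccontr)
    assume "u \<noteq> 0"
    then obtain C where "invertible C" "u v* wedge2 C = vector [0, 0, 0, 0, 0, 1]"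
      using wedge2_normal_form u(2) by metis
    then show False
      using assms(2)[of "(\<lambda>v. v v* wedge2 C) ` V"] u(1) V(1)
      by (metis image_eqI image_wedge2_in_orbit wedge2_orbit_trans)
  qed
  have "f \<noteq> 0"
    by (simp add: f_def vec6_eq_iff)
  \<comment> \<open>Orthogonal projection: the polar form of the Pfaffian pairs \<open>f\<close>
    with \<open>w\<close> to \<open>w $ 3 + w $ 4\<close>, and \<open>f\<close> with itself to
    2.\<close>
  then obtain w0 where w0: "w0 \<notin> vec.span {f}" "V = vec.span {f, w0 - ((w0 $ 3 + w0 $ 4) / 2) *s f}"
    using planes_split[OF \<open>V \<in> planes\<close> V(2), of "\<lambda>w. (w $ 3 + w $ 4) / 2"] by blast
  define w1 where "w1 = w0 - ((w0 $ 3 + w0 $ 4) / 2) *s f"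
  have Vw1: "V = vec.span {f, w1}"
    using w0(2) by (simp add: w1_def)
  have w14: "w1 $ 4 = - w1 $ 3"
    using two by (simp add: w1_def f_def field_simps)
  have "\<nexists>s. - pfaffian w1 = s\<^sup>2"
  proof
    assume "\<exists>s. - pfaffian w1 = s\<^sup>2"
    then obtain s where s: "- pfaffian w1 = s\<^sup>2" by blast
    have "pfaffian (s *s f + w1) = s\<^sup>2 + pfaffian w1"
      using w14 by (simp add: pfaffian_def f_def algebra_simps power2_eq_square)
    also have "\<dots> = 0"
      unfolding s[symmetric] by simp
    finally have "s *s f + w1 = 0"
      by (intro pfaffian_anisotropic) (simp_all add: Vw1 vec.span_add vec.span_scale vec.span_base)
    then have "w0 = ((w0 $ 3 + w0 $ 4) / 2 - s) *s f"
      by (simp add: w1_def vec_eq_iff algebra_simps)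
    then show False
      using w0(1) by (metis insertI1 vec.span_base vec.span_scale)
  qed
  then obtain s where s: "s \<noteq> 0" "- pfaffian w1 = g * s\<^sup>2" and nsq: "\<nexists>t. g * s\<^sup>2 = t\<^sup>2"
    using gen by metis
  have g: "g \<noteq> t\<^sup>2" for t
    using nsq by (metis power_mult_distrib)
  define w where "w = (1 / s) *s w1"
  have Vw: "V = vec.span {f, w}"
    using span_pair_change[of 1 "1 / s" f 0 w1] s by (simp add: Vw1 w_def)
  have w4: "w $ 4 = - w $ 3"
    using w14 by (simp add: w_def)
  \<comment> \<open>This is \<open>- pfaffian w = g\<close>, rewritten with
    \<open>w $ 4 = - w $ 3\<close>.\<close>
  have geq: "g = w $ 3 * w $ 3 + w $ 2 * w $ 5 - w $ 1 * w $ 6"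
    using s w14 by (simp add: w_def pfaffian_def field_simps power2_eq_square)
  \<comment> \<open>Both e_2 and e_3 are orthogonal to e_1 for \<open>f\<close>; one of them
    therefore pairs nontrivially with e_1 under \<open>w\<close> and can be scaled to y.\<close>
  have "w $ 1 \<noteq> 0 \<or> w $ 2 \<noteq> 0"
    using g[of "w $ 3"] geq by (auto simp: power2_eq_square)
  then obtain C :: "'k^4^4" where "invertible C" "f v* wedge2 C = 1 *s f"
    "w v* wedge2 C = 0 *s f + 1 *s vector [0, 1, 0, 0, g, 0]"
  proof (cases "w $ 1 = 0")
    case False
    \<comment> \<open>columns \<open>x, T x, y, T y\<close> with \<open>x = e\<^sub>1\<close> and \<open>y = e\<^sub>2 / w\<^sub>1\<^sub>2\<close>\<close>
    define C :: "'k^4^4" where "C = vector [vector [1, w$3, 0, w$5 / w$1],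
      vector [0, w$2, 1 / w$1, - w$3 / w$1], vector [0, - w$1, 0, 0], vector [0, 0, 0, 1]]"
    have "invertible C"
      by (rule invertible_4I) (use False in \<open>simp_all add: C_def\<close>)
    moreover have "f v* wedge2 C = 1 *s f"
      using False by (simp add: wedge2_action_simps C_def f_def)
    moreover have "w v* wedge2 C = 0 *s f + 1 *s vector [0, 1, 0, 0, g, 0]"
      using False by (simp add: wedge2_action_simps C_def f_def w4 geq field_simps)
    ultimately show ?thesis using that by blast
  next
    case True
    then have w2: "w $ 2 \<noteq> 0"
      using \<open>w $ 1 \<noteq> 0 \<or> w $ 2 \<noteq> 0\<close> by simp
    \<comment> \<open>columns \<open>x, T x, y, T y\<close> with \<open>x = e\<^sub>1\<close> and \<open>y = e\<^sub>3 / w\<^sub>1\<^sub>3\<close>\<close>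
    define C :: "'k^4^4" where "C = vector [vector [1, w$3, 0, w$6 / w$2],
      vector [0, w$2, 0, 0], vector [0, 0, 1 / w$2, - w$3 / w$2], vector [0, 0, 0, 1]]"
    have "invertible C"
      by (rule invertible_4I) (use w2 in \<open>simp_all add: C_def\<close>)
    moreover have "f v* wedge2 C = 1 *s f"
      using w2 by (simp add: wedge2_action_simps C_def f_def)
    moreover have "w v* wedge2 C = 0 *s f + 1 *s vector [0, 1, 0, 0, g, 0]"
      using w2 True by (simp add: wedge2_action_simps C_def f_def w4 geq field_simps)
    ultimately show ?thesis using that by blast
  qed
  then have "V \<in> wedge2_orbit (vec.span {f, vector [0, 1, 0, 0, g, 0]})"
    unfolding Vw by (rule wedge2_orbit_pairI) simp_all
  then show ?thesis
    using V(1) unfolding f_def by (blast intro: wedge2_orbit_sym wedge2_orbit_trans)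
qed

section \<open>Nonsquares, odd cardinality and the count of orbits\<close>

lemma generates_units_nonsquare:
  assumes "generates_units (g :: 'k::field)" "\<nexists>s. d = s\<^sup>2"
  shows "\<exists>s. s \<noteq> 0 \<and> d = g * s\<^sup>2"
proof -
  have "d \<noteq> 0"
    using assms(2) by (metis zero_power2)
  then have "d \<in> range (\<lambda>n::int. g powi n)"
    using assms(1) by (simp add: generates_units_def)
  then obtain n :: int where n: "d = g powi n" by blast
  have "1 \<in> range (\<lambda>n::int. g powi n)" "0 \<notin> range (\<lambda>n::int. g powi n)"
    using assms(1) by (simp_all add: generates_units_def)
  then have "g \<noteq> 0"
    by (metis power_int_1_right rangeI)
  have double: "g powi (2 * m) = (g powi m)\<^sup>2" for m
    by (metis mult.commute power_int_mult power_int_numeral)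
  \<comment> \<open>Even powers of \<open>g\<close> are squares, so a nonsquare is an odd power,
    that is, \<open>g\<close> times a square.\<close>
  have "odd n"
  proof
    assume "even n"
    then obtain m where "n = 2 * m" by (rule evenE)
    then show False using assms(2) n double by blast
  qed
  then obtain m where "n = 2 * m + 1" by (rule oddE)
  then have "d = g * (g powi m)\<^sup>2"
    using n \<open>g \<noteq> 0\<close> by (simp add: power_int_add double)
  then show ?thesis
    using \<open>g \<noteq> 0\<close> by (metis power_int_eq_0_iff)
qed

lemma two_neq_0_odd_card:
  assumes "odd CARD('k::{field, finite})"
  shows "(2 :: 'k) \<noteq> 0"
proof
  assume "(2 :: 'k) = 0"
  then have "CHAR('k) dvd 2"
    using of_nat_eq_0_iff_char_dvd[of 2, where 'a = 'k] by simp
  moreover have "CHAR('k) \<noteq> 1"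
    by simp
  ultimately have "CHAR('k) = 2"
    by (metis prime_nat_iff two_is_prime_nat)
  then show False
    using CHAR_dvd_CARD[where 'a = 'k] assms by simp
qed

theorem theorem2:
  fixes p r :: nat and g :: "'k::{field, finite}"
  assumes "prime p" and "odd p" and "r > 0" and "CARD('k) = p ^ r"
    and "generates_units g"
  shows "card (wedge2_orbit ` (planes :: ('k^6) set set)) \<le> 4 \<and>
    (\<forall>W \<in> (planes :: ('k^6) set set). \<exists>M \<in>
       {vector [vector [0, 0, 0, 0, 0, 1],
                vector [1, 0, 0, 0, 0, 0]],
        vector [vector [0, 0, 0, 0, 0, 1],
                vector [0, 0, 1, 0, 0, 0]],
        vector [vector [0, 0, 0, 0, 0, 1],
                vector [0, 0, 1, 1, 0, 0]],
        vector [vector [0, 0, 1, 1, 0, 0],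
                vector [0, 1, 0, 0, g, 0]]} :: ('k^6^2) set.
       W \<in> wedge2_orbit (row_space M))" (is "_ \<and> (\<forall>W \<in> _. \<exists>M \<in> ?Ms. _)")
proof
  have two: "(2 :: 'k) \<noteq> 0"
    using assms by (intro two_neq_0_odd_card) simp
  show reps: "\<forall>W \<in> (planes :: ('k^6) set set). \<exists>M \<in> ?Ms. W \<in> wedge2_orbit (row_space M)"
  proof
    fix W :: "('k^6) set" assume W: "W \<in> planes"
    show "\<exists>M \<in> ?Ms. W \<in> wedge2_orbit (row_space M)"
    \<comment> \<open>The whole orbit of \<open>W\<close> is searched for e_34, because a
      decomposable vector of \<open>W\<close> reaches e_34 only after a group element is
      applied.\<close>
    proof (cases "\<exists>V \<in> wedge2_orbit W. vector [0, 0, 0, 0, 0, 1] \<in> V")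
      case True
      then obtain V where V: "V \<in> wedge2_orbit W" "vector [0, 0, 0, 0, 0, 1] \<in> V" by blast
      then have "\<exists>M \<in> ?Ms. V \<in> wedge2_orbit (row_space M)"
        using plane_with_decomposable[OF planes_wedge2_orbit[OF W V(1)] V(2)]
        by (auto simp: row_space_vector_2)
      then show ?thesis
        using V(1) by (meson wedge2_orbit_sym wedge2_orbit_trans)
    next
      case False
      then show ?thesis
        using plane_without_decomposable[OF W _ two generates_units_nonsquare[OF assms(5)]]
        by (auto simp: row_space_vector_2)
    qed
  qed
  have "wedge2_orbit ` planes \<subseteq> (\<lambda>M. wedge2_orbit (row_space M)) ` ?Ms"
    using reps wedge2_orbit_eq by fastforce
  then have "card (wedge2_orbit ` (planes :: ('k^6) set set)) \<le> card ((\<lambda>M. wedge2_orbit (row_space M)) ` ?Ms)"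
    by (intro card_mono) auto
  also have "\<dots> \<le> card ?Ms"
    by (intro card_image_le) auto
  also have "\<dots> \<le> 4"
    by (simp add: card_insert_if)
  finally show "card (wedge2_orbit ` (planes :: ('k^6) set set)) \<le> 4" .
qed

end
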